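(* Let $A,B,H,K$ be logically independent events, let $x,y\in[0,1]$, and consider the conjunction $(A|H)\wedge(B|K)$ with $P(A|H)=x$, $P(B|K)=y$. Given any $\lambda\in[0,+\infty]$, let $T_\lambda$ be the Frank t-norm with parameter $\lambda$. Then the assessment $z=T_\lambda(x,y)$ on $(A|H)\wedge(B|K)$ is a coherent extension of the assessment $(x,y)$ on $\{A|H,B|K\}$ (that is, $(x,y,z)$ is a coherent assessment on $\{A|H,\,B|K,\,(A|H)\wedge(B|K)\}$); moreover, with this $z$, $(A|H)\wedge(B|K)=T_\lambda(A|H,B|K)$ as random quantities. Conversely, given any coherent extension $z=\mathbb{P}[(A|H)\wedge(B|K)]$ of $(x,y)$, there exists $\lambda\in[0,+\infty]$ such that $z=T_\lambda(x,y)$.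
   Context: **Events.** Events are subsets of a set $\Omega$ of elementary outcomes; $\overline{E}$ is the complement of $E$, juxtaposition $EF$ denotes intersection, $\vee$ denotes union, and an event is true at an outcome belonging to it. Events $E_1,\dots,E_n$ are logically independent if all $2^n$ intersections $E_1^*\cdots E_n^*$, with $E_i^*\in\{E_i,\overline{E}_i\}$, are nonempty. **Conditional events.** For $H\neq\emptyset$ and an assessed probability $P(A|H)=x$, the conditional event $A|H$ is identified with the random quantity equal to $1$ on $AH$, $0$ on $\overline{A}H$, and $x$ on $\overline{H}$. It is a conditional random quantity with conditioning event $H$ and prevision $x$. **Conjunction.** Given $P(A|H)=x$, $P(B|K)=y$, the conjunction $(A|H)\wedge(B|K)$, with prevision $z=\mathbb{P}[(A|H)\wedge(B|K)]$, is the random quantity equal to: $1$ on $AHBK$; $0$ on $\overline{A}H\vee\overline{B}K$; $x$ on $\overline{H}BK$; $y$ on $AH\overline{K}$; $z$ on $\overline{H}\,\overline{K}$. It is a conditional random quantity with conditioning event $H\vee K$ and prevision $z$. **Coherence.** Let $\mathcal F=\{X_1|H_1,\dots,X_n|H_n\}$ be a finite family of conditional random quantities, where $X_i$ takes finitely many real values when the conditioning event $H_i\ne\emptyset$ is true, and let $\mathcal M=(\mu_1,\dots,\mu_n)\in\mathbb R^n$ be a (prevision) assessment, $\mu_i=\mathbb P(X_i|H_i)$. Let $C_1,\dots,C_m$ be the constituents contained in $H_1\vee\cdots\vee H_n$, i.e. the nonempty atoms of the finite partition generated by the events $H_i$ and the events $(X_i=\text{value})\cap H_i$. To $C_h$ associate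 $Q_h=(q_{h1},\dots,q_{hn})$, where $q_{hi}$ is the value of $X_i$ on $C_h$ if $C_h\subseteq H_i$, and $q_{hi}=\mu_i$ if $C_h\subseteq\overline{H}_i$. Let $S$ be the set of vectors $(\lambda_1,\dots,\lambda_m)$ with $\lambda_h\ge 0$, $\sum_h\lambda_h=1$, $\sum_h\lambda_hQ_h=\mathcal M$, and, when $S\neq\emptyset$, let $I_0=\{i:\max_{\Lambda\in S}\sum_{h:C_h\subseteq H_i}\lambda_h=0\}$. Then $\mathcal M$ is coherent on $\mathcal F$ if and only if (i) $S\neq\emptyset$, and (ii) if $I_0\ne\emptyset$, then the sub-assessment $(\mu_i,\ i\in I_0)$ on $\{X_i|H_i,\ i\in I_0\}$ is coherent (the recursion terminates because $I_0$ is a proper subset of $\{1,\dots,n\}$). **Frank t-norms.** For $\lambda\in[0,+\infty]$, $T_\lambda:[0,1]^2\to[0,1]$ is defined by $T_0(u,v)=\min\{u,v\}$, $T_1(u,v)=uv$, $T_{+\infty}(u,v)=\max\{u+v-1,0\}$, and $T_\lambda(u,v)=\log_\lambda\!\left(1+\frac{(\lambda^u-1)(\lambda^v-1)}{\lambda-1}\right)$ otherwise. *)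

theory Defs
  imports Complex_Main "HOL-Library.Extended_Nonnegative_Real"
begin

definition logically_independent :: "'w set list \<Rightarrow> bool" where
  "logically_independent Es \<longleftrightarrow>
     (\<forall>s :: nat \<Rightarrow> bool. (\<Inter>i<length Es. if s i then Es ! i else - (Es ! i)) \<noteq> {})"

definition cond_event :: "'w set \<Rightarrow> 'w set \<Rightarrow> real \<Rightarrow> 'w \<Rightarrow> real" where
  "cond_event A H x \<omega> =
     (if \<omega> \<in> A \<inter> H then 1 else if \<omega> \<in> - A \<inter> H then 0 else x)"

text \<open>The conjunction of \<open>A|H\<close> (with probability \<open>x\<close>) and \<open>B|K\<close> (with probability \<open>y\<close>), whose
  own prevision is \<open>z\<close>.\<close>

definition conjunction ::
  "'w set \<Rightarrow> 'w set \<Rightarrow> real \<Rightarrow> 'w set \<Rightarrow> 'w set \<Rightarrow> real \<Rightarrow> real \<Rightarrow> 'w \<Rightarrow> real" where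
  "conjunction A H x B K y z \<omega> =
     (if \<omega> \<in> A \<inter> H \<inter> B \<inter> K then 1
      else if \<omega> \<in> (- A \<inter> H) \<union> (- B \<inter> K) then 0
      else if \<omega> \<in> - H \<inter> B \<inter> K then x
      else if \<omega> \<in> A \<inter> H \<inter> - K then y
      else z)"

definition atoms :: "'w set set \<Rightarrow> 'w set set" where
  "atoms \<E> = {C. C \<noteq> {} \<and> (\<exists>T\<subseteq>\<E>. C = (\<Inter>E\<in>\<E>. if E \<in> T then E else - E))}"

text \<open>A family of conditional random quantities \<open>X i | H i\<close> has an index set \<open>I\<close>; subfamilies are
  obtained by shrinking \<open>I\<close>. Only the values of \<open>X i\<close> on \<open>H i\<close> matter here.\<close>

definition constituents ::
  "'i set \<Rightarrow> ('i \<Rightarrow> 'w \<Rightarrow> real) \<Rightarrow> ('i \<Rightarrow> 'w set) \<Rightarrow> 'w set set" where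
  "constituents I X H =
     {C \<in> atoms (H ` I \<union> {X i -` {v} \<inter> H i | i v. i \<in> I \<and> v \<in> X i ` H i}).
        C \<subseteq> (\<Union>i\<in>I. H i)}"

text \<open>\<open>X i\<close> is constant on every constituent contained in \<open>H i\<close>, so \<open>the_elem\<close> returns that value.\<close>

definition point ::
  "('i \<Rightarrow> 'w \<Rightarrow> real) \<Rightarrow> ('i \<Rightarrow> 'w set) \<Rightarrow> ('i \<Rightarrow> real) \<Rightarrow> 'w set \<Rightarrow> 'i \<Rightarrow> real" where
  "point X H \<mu> C i = (if C \<subseteq> H i then the_elem (X i ` C) else \<mu> i)"

text \<open>The vectors of weights are functions on constituents; their values elsewhere are
  irrelevant.\<close>

definition solutions ::
  "'i set \<Rightarrow> ('i \<Rightarrow> 'w \<Rightarrow> real) \<Rightarrow> ('i \<Rightarrow> 'w set) \<Rightarrow> ('i \<Rightarrow> real) \<Rightarrow> ('w set \<Rightarrow> real) set" where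
  "solutions I X H \<mu> =
     {\<Lambda>. (\<forall>C\<in>constituents I X H. 0 \<le> \<Lambda> C) \<and>
         (\<Sum>C\<in>constituents I X H. \<Lambda> C) = 1 \<and>
         (\<forall>i\<in>I. (\<Sum>C\<in>constituents I X H. \<Lambda> C * point X H \<mu> C i) = \<mu> i)}"

definition is_maximum :: "real set \<Rightarrow> real \<Rightarrow> bool" where
  "is_maximum V m \<longleftrightarrow> m \<in> V \<and> (\<forall>v\<in>V. v \<le> m)"

definition null_indices ::
  "'i set \<Rightarrow> ('i \<Rightarrow> 'w \<Rightarrow> real) \<Rightarrow> ('i \<Rightarrow> 'w set) \<Rightarrow> ('i \<Rightarrow> real) \<Rightarrow> 'i set" where
  "null_indices I X H \<mu> =
     {i \<in> I. is_maximum
        ((\<lambda>\<Lambda>. \<Sum>C\<in>{C \<in> constituents I X H. C \<subseteq> H i}. \<Lambda> C) ` solutions I X H \<mu>) 0}"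

text \<open>The recursion strictly decreases the finite index set (\<open>null_indices_psubset\<close> below), so
  the least predicate closed under this rule is the only one satisfying the recursive
  characterization \<open>coherent_on.simps\<close>.\<close>

inductive coherent_on ::
  "('i \<Rightarrow> 'w \<Rightarrow> real) \<Rightarrow> ('i \<Rightarrow> 'w set) \<Rightarrow> ('i \<Rightarrow> real) \<Rightarrow> 'i set \<Rightarrow> bool"
  for X :: "'i \<Rightarrow> 'w \<Rightarrow> real" and H :: "'i \<Rightarrow> 'w set" and \<mu> :: "'i \<Rightarrow> real" where
  "\<lbrakk>finite I; \<forall>i\<in>I. H i \<noteq> {} \<and> finite (X i ` H i);
    solutions I X H \<mu> \<noteq> {};
    null_indices I X H \<mu> \<noteq> {} \<longrightarrow> coherent_on X H \<mu> (null_indices I X H \<mu>)\<rbrakk>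
   \<Longrightarrow> coherent_on X H \<mu> I"

lemma null_indices_psubset:
  assumes "solutions I X H \<mu> \<noteq> {}"
  shows "null_indices I X H \<mu> \<subset> I"
proof -
  obtain \<Lambda> where \<Lambda>: "\<Lambda> \<in> solutions I X H \<mu>"
    using assms by blast
  let ?Cs = "constituents I X H"
  have nonneg: "\<And>C. C \<in> ?Cs \<Longrightarrow> 0 \<le> \<Lambda> C" and sum1: "(\<Sum>C\<in>?Cs. \<Lambda> C) = 1"
    using \<Lambda> by (auto simp: solutions_def)
  then have fin: "finite ?Cs"
    by (metis sum.infinite zero_neq_one)
  obtain C where C: "C \<in> ?Cs" "\<Lambda> C \<noteq> 0"
    using sum1 by (metis sum.neutral zero_neq_one)
  have "C \<noteq> {}" "C \<subseteq> (\<Union>i\<in>I. H i)"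
    using C(1) unfolding constituents_def atoms_def by simp_all
  then obtain \<omega> i where i: "\<omega> \<in> C" "\<omega> \<in> H i" "i \<in> I"
    by blast
  obtain T where T: "C = (\<Inter>E\<in>H ` I \<union> {X i -` {v} \<inter> H i | i v. i \<in> I \<and> v \<in> X i ` H i}.
      if E \<in> T then E else - E)"
    using C(1) unfolding constituents_def atoms_def mem_Collect_eq by (elim conjE exE)
  have "C \<subseteq> (if H i \<in> T then H i else - H i)"
    unfolding T using i(3) by (intro INF_lower) simp
  then have sub: "C \<subseteq> H i"
    using i by (auto split: if_splits)
  have "\<Lambda> C \<le> (\<Sum>C\<in>{C \<in> ?Cs. C \<subseteq> H i}. \<Lambda> C)"
    using C(1) sub fin nonneg by (intro member_le_sum) auto
  moreover have "0 < \<Lambda> C"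
    using C nonneg[of C] by simp
  ultimately have "i \<notin> null_indices I X H \<mu>"
    using \<Lambda> unfolding null_indices_def is_maximum_def by fastforce
  then show ?thesis
    using i(3) by (auto simp: null_indices_def)
qed

text \<open>Families listed as pairs of a random quantity and its conditioning event.\<close>

definition coherent :: "(('w \<Rightarrow> real) \<times> 'w set) list \<Rightarrow> real list \<Rightarrow> bool" where
  "coherent F M \<longleftrightarrow> length F = length M \<and>
     coherent_on (\<lambda>i. fst (F ! i)) (\<lambda>i. snd (F ! i)) (\<lambda>i. M ! i) {..<length F}"

text \<open>The type \<open>ennreal\<close> is the parameter range from 0 to infinity, both included. The values are
  meant for arguments in the unit interval.\<close>

definition frank :: "ennreal \<Rightarrow> real \<Rightarrow> real \<Rightarrow> real" where
  "frank l u v =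
     (if l = 0 then min u v
      else if l = 1 then u * v
      else if l = \<infinity> then max (u + v - 1) 0
      else log (enn2real l)
             (1 + (enn2real l powr u - 1) * (enn2real l powr v - 1) / (enn2real l - 1)))"

end

theory Submission
  imports Defs
begin

(* Both directions reduce to the Frechet bounds max (x + y - 1) 0 <= z <= min x y. A coherent z obeys
   them because every point Q_h does. Conversely, for such z the weights z, x - z, y - z,
   1 - x - y + z on the four constituents contained in HK solve the system; all conditioning events
   then have weight 1, so the set I_0 is empty. The Frank t-norms have 0 and 1 as absorbing and
   neutral elements, which gives the equality of random quantities, and they sweep out the whole
   Frechet interval: the bounds themselves are T_infinity and T_0, and
   strictly between them z = T_a x y is equivalent to (a^x - 1) (a^y - 1) = (a^z - 1) (a - 1), whose
   solution a comes from the intermediate value theorem, on (0, 1) if z > x y and on (1, infinity)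
   if z < x y: the difference of the two sides is asymptotic to (x y - z) (a - 1)^2 at 1, to a^z
   at 0 and to -a^(z + 1) at infinity. *)

section \<open>Constituents and coherence\<close>

lemma atom_dichotomy:
  assumes "C \<in> atoms G" "E \<in> G"
  shows "C \<subseteq> E \<or> C \<inter> E = {}"
proof -
  obtain T where T: "C = (\<Inter>E\<in>G. if E \<in> T then E else - E)"
    using assms(1) unfolding atoms_def mem_Collect_eq by (elim conjE exE)
  have "C \<subseteq> (if E \<in> T then E else - E)"
    unfolding T using assms(2) by (intro INF_lower)
  then show ?thesis by (auto split: if_splits)
qed

text \<open>An outcome determines the sign of every generator: any \<open>T\<close> describing an
  atom through it must agree on \<open>G\<close> with the set of generators containing it.\<close>

lemma atom_containing: "\<exists>!C. C \<in> atoms G \<and> \<omega> \<in> C"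
proof (rule ex1I)
  define S where "S = {E \<in> G. \<omega> \<in> E}"
  define C where "C = (\<Inter>E\<in>G. if E \<in> S then E else - E)"
  have "\<omega> \<in> C"
    unfolding C_def by (rule INT_I) (simp add: S_def)
  moreover have "S \<subseteq> G"
    by (auto simp: S_def)
  ultimately show "C \<in> atoms G \<and> \<omega> \<in> C"
    unfolding atoms_def mem_Collect_eq using C_def by blast
  fix D assume D: "D \<in> atoms G \<and> \<omega> \<in> D"
  then obtain T where T: "D = (\<Inter>E\<in>G. if E \<in> T then E else - E)"
    unfolding atoms_def mem_Collect_eq by (elim conjE exE)
  have "E \<in> T \<longleftrightarrow> E \<in> S" if "E \<in> G" for E
  proof -
    have "\<omega> \<in> (if E \<in> T then E else - E)"
      using D[THEN conjunct2, unfolded T] that by (rule INT_D)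
    then show ?thesis
      using that by (auto simp: S_def split: if_splits)
  qed
  then show "D = C"
    unfolding T C_def by (intro INF_cong) simp_all
qed

lemma finite_atoms:
  assumes "finite G"
  shows "finite (atoms G)"
proof (rule finite_subset)
  show "atoms G \<subseteq> (\<lambda>T. \<Inter>E\<in>G. if E \<in> T then E else - E) ` Pow G"
    unfolding atoms_def by blast
  show "finite ((\<lambda>T. \<Inter>E\<in>G. if E \<in> T then E else - E) ` Pow G)"
    using assms by simp
qed

lemma finite_constituents:
  assumes "finite I" "\<And>i. i \<in> I \<Longrightarrow> finite (X i ` H i)"
  shows "finite (constituents I X H)"
proof -
  have "{X i -` {v} \<inter> H i | i v. i \<in> I \<and> v \<in> X i ` H i}
      = (\<Union>i\<in>I. (\<lambda>v. X i -` {v} \<inter> H i) ` X i ` H i)"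
    by blast
  then have "finite (H ` I \<union> {X i -` {v} \<inter> H i | i v. i \<in> I \<and> v \<in> X i ` H i})"
    using assms by simp
  from finite_atoms[OF this] show ?thesis
    unfolding constituents_def by (rule rev_finite_subset) blast
qed

lemma constituent_dichotomy:
  assumes "C \<in> constituents I X H" "i \<in> I"
  shows "C \<subseteq> H i \<or> C \<inter> H i = {}"
  using assms unfolding constituents_def by (auto dest!: atom_dichotomy[where E = "H i"])

text \<open>An atom meeting \<open>H i\<close> is contained in it, so the restriction to atoms
  inside the union discards no atom through an outcome of \<open>H i\<close>.\<close>

lemma constituent_containing:
  assumes "\<omega> \<in> H i" "i \<in> I"
  shows "\<exists>!C. C \<in> constituents I X H \<and> \<omega> \<in> C"
proof -
  let ?G = "H ` I \<union> {X i -` {v} \<inter> H i | i v. i \<in> I \<and> v \<in> X i ` H i}"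
  have "C \<subseteq> (\<Union>i\<in>I. H i)" if "C \<in> atoms ?G" "\<omega> \<in> C" for C
    using atom_dichotomy[OF that(1), of "H i"] that(2) assms by blast
  then have "C \<in> constituents I X H \<and> \<omega> \<in> C \<longleftrightarrow> C \<in> atoms ?G \<and> \<omega> \<in> C" for C
    unfolding constituents_def by blast
  then show ?thesis
    using atom_containing[of ?G \<omega>] by simp
qed

text \<open>Lets the points Q_h be read off at single outcomes. Inside \<open>H i\<close>, the event
  that \<open>X i\<close> has its value at \<open>\<omega>\<close> is a generator, so
  \<open>X i\<close> is constant on \<open>C\<close>; outside, \<open>point\<close> defaults to the
  prevision, and so does \<open>X i\<close> by the hypothesis \<open>outside\<close>.\<close>

lemma point_eq:
  assumes C: "C \<in> constituents I X H" and i: "i \<in> I" and \<omega>: "\<omega> \<in> C"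
    and outside: "\<omega> \<notin> H i \<Longrightarrow> X i \<omega> = \<mu> i"
  shows "point X H \<mu> C i = X i \<omega>"
proof (cases "C \<subseteq> H i")
  case True
  let ?E = "X i -` {X i \<omega>} \<inter> H i"
  have "C \<subseteq> ?E \<or> C \<inter> ?E = {}"
    using C i \<omega> True unfolding constituents_def
    by (intro atom_dichotomy[where G = "H ` I \<union> {X i -` {v} \<inter> H i | i v. i \<in> I \<and> v \<in> X i ` H i}"]) blast+
  then have "X i ` C = {X i \<omega>}"
    using \<omega> True by auto
  then show ?thesis
    using True by (simp add: point_def)
next
  case False
  then have "\<omega> \<notin> H i"
    using constituent_dichotomy[OF C i] \<omega> by blast
  then show ?thesis
    using False outside by (simp add: point_def)
qed

text \<open>Necessary condition for coherence, from solvability of the system alone: the assessment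
  is a convex combination of the points Q_h, so an affine functional nonnegative at all of them is
  nonnegative at the assessment.\<close>

lemma coherent_on_affine_nonneg:
  assumes "coherent_on X H \<mu> I"
    and outside: "\<And>i \<omega>. i \<in> I \<Longrightarrow> \<omega> \<notin> H i \<Longrightarrow> X i \<omega> = \<mu> i"
    and nonneg: "\<And>i \<omega>. i \<in> I \<Longrightarrow> \<omega> \<in> H i \<Longrightarrow> 0 \<le> c + (\<Sum>j\<in>I. d j * X j \<omega>)"
  shows "0 \<le> c + (\<Sum>j\<in>I. d j * \<mu> j)"
proof -
  let ?Cs = "constituents I X H"
  obtain \<Lambda> where "\<Lambda> \<in> solutions I X H \<mu>"
    using assms(1) by cases blast
  then have \<Lambda>: "\<And>C. C \<in> ?Cs \<Longrightarrow> 0 \<le> \<Lambda> C" "(\<Sum>C\<in>?Cs. \<Lambda> C) = 1"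
      "\<And>i. i \<in> I \<Longrightarrow> (\<Sum>C\<in>?Cs. \<Lambda> C * point X H \<mu> C i) = \<mu> i"
    by (auto simp: solutions_def)
  \<comment> \<open>A constituent is nonempty and lies in the union of the conditioning events, so
    its point is the value vector at some outcome covered by \<open>nonneg\<close>.\<close>
  have point_nonneg: "0 \<le> c + (\<Sum>j\<in>I. d j * point X H \<mu> C j)" if C: "C \<in> ?Cs" for C
  proof -
    obtain \<omega> i where \<omega>: "\<omega> \<in> C" "i \<in> I" "\<omega> \<in> H i"
      using C unfolding constituents_def atoms_def by blast
    have "(\<Sum>j\<in>I. d j * point X H \<mu> C j) = (\<Sum>j\<in>I. d j * X j \<omega>)"
      using point_eq[OF C _ \<omega>(1)] outside by (intro sum.cong) auto
    then show ?thesis using nonneg \<omega> by simp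
  qed
  have "0 \<le> (\<Sum>C\<in>?Cs. \<Lambda> C * (c + (\<Sum>j\<in>I. d j * point X H \<mu> C j)))"
    using \<Lambda>(1) point_nonneg by (intro sum_nonneg mult_nonneg_nonneg)
  also have "\<dots> = c * (\<Sum>C\<in>?Cs. \<Lambda> C)
      + (\<Sum>C\<in>?Cs. \<Sum>j\<in>I. d j * (\<Lambda> C * point X H \<mu> C j))"
    by (simp add: sum.distrib distrib_left sum_distrib_left algebra_simps)
  also have "(\<Sum>C\<in>?Cs. \<Sum>j\<in>I. d j * (\<Lambda> C * point X H \<mu> C j))
      = (\<Sum>j\<in>I. d j * (\<Sum>C\<in>?Cs. \<Lambda> C * point X H \<mu> C j))"
    unfolding sum_distrib_left by (rule sum.swap)
  also have "\<dots> = (\<Sum>j\<in>I. d j * \<mu> j)"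
    using \<Lambda>(3) by simp
  finally show ?thesis using \<Lambda>(2) by simp
qed

text \<open>Sufficient condition: a finitely supported probability living inside all conditioning
  events at once and having the assessed means. Each conditioning event then has weight 1, and the
  recursion stops at its first stage.\<close>

lemma coherent_on_outcome_weights:
  fixes X :: "'i \<Rightarrow> 'w \<Rightarrow> real"
  assumes I: "finite I" "I \<noteq> {}" "\<And>i. i \<in> I \<Longrightarrow> finite (X i ` H i)"
    and W: "finite W" "\<And>i. i \<in> I \<Longrightarrow> W \<subseteq> H i"
    and w: "\<And>\<omega>. \<omega> \<in> W \<Longrightarrow> 0 \<le> w \<omega>" "(\<Sum>\<omega>\<in>W. w \<omega>) = 1"
    and mean: "\<And>i. i \<in> I \<Longrightarrow> (\<Sum>\<omega>\<in>W. w \<omega> * X i \<omega>) = \<mu> i"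
  shows "coherent_on X H \<mu> I"
proof -
  let ?Cs = "constituents I X H"
  \<comment> \<open>Image of the weights \<open>w\<close> under the map sending an outcome to its
    constituent.\<close>
  let ?\<Lambda> = "\<lambda>C. \<Sum>\<omega>\<in>W \<inter> C. w \<omega>"
  have fin: "finite ?Cs"
    using finite_constituents I by blast
  have cell: "\<exists>!C. C \<in> ?Cs \<and> \<omega> \<in> C" if "\<omega> \<in> W" for \<omega>
  proof -
    obtain i where "i \<in> I" using I(2) by blast
    then show ?thesis
      using W(2) that by (intro constituent_containing) auto
  qed
  \<comment> \<open>The constituents partition \<open>W\<close>, so a sum over \<open>W\<close> may
    be taken cell by cell.\<close>
  have regroup: "(\<Sum>C\<in>?Cs. \<Sum>\<omega>\<in>W \<inter> C. f \<omega>) = (\<Sum>\<omega>\<in>W. f \<omega>)" for f :: "'w \<Rightarrow> real"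
  proof -
    have "(\<Sum>C\<in>?Cs. \<Sum>\<omega>\<in>W \<inter> C. f \<omega>) = (\<Sum>C\<in>?Cs. \<Sum>\<omega>\<in>W. if \<omega> \<in> C then f \<omega> else 0)"
      using W(1) by (simp add: sum.inter_restrict)
    also have "\<dots> = (\<Sum>\<omega>\<in>W. \<Sum>C\<in>?Cs. if \<omega> \<in> C then f \<omega> else 0)"
      by (rule sum.swap)
    also have "\<dots> = (\<Sum>\<omega>\<in>W. f \<omega>)"
    proof (rule sum.cong[OF refl])
      fix \<omega> assume "\<omega> \<in> W"
      then obtain C where C: "C \<in> ?Cs" "\<And>D. D \<in> ?Cs \<Longrightarrow> \<omega> \<in> D \<longleftrightarrow> C = D"
        using cell[of \<omega>] by blast
      then have "(\<Sum>D\<in>?Cs. if \<omega> \<in> D then f \<omega> else 0) = (\<Sum>D\<in>?Cs. if C = D then f \<omega> else 0)"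
        by (intro sum.cong refl) simp
      then show "(\<Sum>C\<in>?Cs. if \<omega> \<in> C then f \<omega> else 0) = f \<omega>"
        using C(1) fin by simp
    qed
    finally show ?thesis .
  qed
  have "(\<Sum>C\<in>?Cs. ?\<Lambda> C * point X H \<mu> C i) = \<mu> i" if "i \<in> I" for i
  proof -
    have "(\<Sum>C\<in>?Cs. ?\<Lambda> C * point X H \<mu> C i) = (\<Sum>C\<in>?Cs. \<Sum>\<omega>\<in>W \<inter> C. w \<omega> * X i \<omega>)"
      unfolding sum_distrib_right
      using W(2) that by (intro sum.cong refl arg_cong2[where f = "(*)"] point_eq) auto
    then show ?thesis using regroup mean that by simp
  qed
  then have sol: "?\<Lambda> \<in> solutions I X H \<mu>"
    using regroup[of w] w by (auto simp: solutions_def intro!: sum_nonneg)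
  have "i \<notin> null_indices I X H \<mu>" if "i \<in> I" for i
  proof -
    \<comment> \<open>A constituent not contained in \<open>H i\<close> is disjoint from it, hence
      from \<open>W\<close>, and carries no weight.\<close>
    have "(\<Sum>C\<in>{C \<in> ?Cs. C \<subseteq> H i}. ?\<Lambda> C) = (\<Sum>C\<in>?Cs. ?\<Lambda> C)"
    proof (rule sum.mono_neutral_left[OF fin])
      show "\<forall>C\<in>?Cs - {C \<in> ?Cs. C \<subseteq> H i}. ?\<Lambda> C = 0"
      proof
        fix C assume "C \<in> ?Cs - {C \<in> ?Cs. C \<subseteq> H i}"
        then have "W \<inter> C = {}"
          using constituent_dichotomy[OF _ that, of C X H] W(2)[OF that] by blast
        then show "?\<Lambda> C = 0" by simp
      qed
    qed blast
    then have "(\<Sum>C\<in>{C \<in> ?Cs. C \<subseteq> H i}. ?\<Lambda> C) = 1"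
      using regroup w(2) by simp
    then have "1 \<in> (\<lambda>\<Lambda>. \<Sum>C\<in>{C \<in> ?Cs. C \<subseteq> H i}. \<Lambda> C) ` solutions I X H \<mu>"
      using sol by (intro image_eqI[where x = ?\<Lambda>]) simp_all
    \<comment> \<open>The value 1 is attained, so 0 cannot be the maximum.\<close>
    then show ?thesis
      unfolding null_indices_def is_maximum_def by force
  qed
  then have "null_indices I X H \<mu> = {}"
    by (auto simp: null_indices_def)
  moreover have "W \<noteq> {}" using w(2) by auto
  then have "H i \<noteq> {}" if "i \<in> I" for i
    using W(2)[OF that] by blast
  ultimately show ?thesis
    using I sol by (intro coherent_on.intros) auto
qed

section \<open>Coherent previsions of the conjunction\<close>

lemma logically_independent_outcome:
  assumes "logically_independent [A, B, H, K]"
  shows "\<exists>\<omega>. (\<omega> \<in> A \<longleftrightarrow> a) \<and> (\<omega> \<in> B \<longleftrightarrow> b) \<and> \<omega> \<in> H \<and> \<omega> \<in> K"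
proof -
  \<comment> \<open>The signs of \<open>A\<close> and \<open>B\<close> are free; positions 2 and 3,
    that is \<open>H\<close> and \<open>K\<close>, are taken positively.\<close>
  define s where "s = (\<lambda>i::nat. if i = 0 then a else if i = 1 then b else True)"
  obtain \<omega> where \<omega>: "\<omega> \<in> (\<Inter>i<length [A, B, H, K]. if s i then [A, B, H, K] ! i else - ([A, B, H, K] ! i))"
    using assms unfolding logically_independent_def by blast
  have "\<omega> \<in> (if s i then [A, B, H, K] ! i else - ([A, B, H, K] ! i))" if "i < 4" for i
    using \<omega> that by simp
  from this[of 0] this[of 1] this[of 2] this[of 3] show ?thesis
    by (intro exI[of _ \<omega>]) (auto simp: s_def split: if_splits)
qed

lemma finite_image_cond_event: "finite (cond_event A H x ` S)"
  by (rule finite_subset[of _ "{0, 1, x}"]) (auto simp: cond_event_def)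

lemma finite_image_conjunction: "finite (conjunction A H x B K y z ` S)"
  by (rule finite_subset[of _ "{0, 1, x, y, z}"]) (auto simp: conjunction_def)

text \<open>Turns the two coherence claims of the theorem into statements about \<open>frank\<close>
  and real numbers.\<close>

lemma coherent_conjunction_iff_Frechet:
  fixes x y z :: real
  assumes indep: "logically_independent [A, B, H, K]"
    and x: "x \<in> {0..1}" and y: "y \<in> {0..1}"
  shows "coherent [(cond_event A H x, H), (cond_event B K y, K),
           (conjunction A H x B K y z, H \<union> K)] [x, y, z] \<longleftrightarrow>
         max (x + y - 1) 0 \<le> z \<and> z \<le> min x y"
proof -
  let ?F = "[(cond_event A H x, H), (cond_event B K y, K), (conjunction A H x B K y z, H \<union> K)]"
  let ?X = "\<lambda>i. fst (?F ! i)" and ?H = "\<lambda>i. snd (?F ! i)" and ?\<mu> = "\<lambda>i. [x, y, z] ! i"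
  have coherent: "coherent ?F [x, y, z] \<longleftrightarrow> coherent_on ?X ?H ?\<mu> {0, 1, 2}"
    by (simp add: coherent_def lessThan_Suc insert_commute numeral_2_eq_2)
  show ?thesis
  proof
    assume "coherent ?F [x, y, z]"
    then have coh: "coherent_on ?X ?H ?\<mu> {0, 1, 2}"
      using coherent by simp
    have outside: "?X i \<omega> = ?\<mu> i" if "i \<in> {0, 1, 2}" "\<omega> \<notin> ?H i" for i \<omega>
      using that by (auto simp: cond_event_def conjunction_def)
    have affine: "0 \<le> c + p * x + q * y + r * z"
      if "\<And>\<omega>. \<omega> \<in> H \<union> K \<Longrightarrow> 0 \<le> c + p * cond_event A H x \<omega> + q * cond_event B K y \<omega>
            + r * conjunction A H x B K y z \<omega>" for c p q r
    proof -
      have "0 \<le> c + (\<Sum>j\<in>{0, 1, 2}. [p, q, r] ! j * ?\<mu> j)"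
      proof (rule coherent_on_affine_nonneg[OF coh outside])
        fix i \<omega> assume "i \<in> {0, 1, 2 :: nat}" "\<omega> \<in> ?H i"
        then have "\<omega> \<in> H \<union> K" by auto
        from that[OF this] show "0 \<le> c + (\<Sum>j\<in>{0, 1, 2}. [p, q, r] ! j * ?X j \<omega>)"
          by (simp add: add.assoc)
      qed
      then show ?thesis by (simp add: add.assoc)
    qed
    \<comment> \<open>The Frechet bounds are four affine inequalities. On
      \<open>H \<union> K\<close> the conjunction never takes its own prevision \<open>z\<close> as
      default value, so each check involves only \<open>x\<close> and \<open>y\<close> in the unit
      interval.\<close>
    have "0 \<le> 1 + (-1) * x + (-1) * y + 1 * z"
      using x y by (intro affine) (auto simp: cond_event_def conjunction_def)
    moreover have "0 \<le> 0 + 0 * x + 0 * y + 1 * z"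
      using x y by (intro affine) (auto simp: conjunction_def)
    moreover have "0 \<le> 0 + 1 * x + 0 * y + (-1) * z"
      using x y by (intro affine) (auto simp: cond_event_def conjunction_def)
    moreover have "0 \<le> 0 + 0 * x + 1 * y + (-1) * z"
      using x y by (intro affine) (auto simp: cond_event_def conjunction_def)
    ultimately show "max (x + y - 1) 0 \<le> z \<and> z \<le> min x y" by simp
  next
    assume z: "max (x + y - 1) 0 \<le> z \<and> z \<le> min x y"
    obtain \<omega>1 where 1: "\<omega>1 \<in> A" "\<omega>1 \<in> B" "\<omega>1 \<in> H" "\<omega>1 \<in> K"
      using logically_independent_outcome[OF indep, of True True] by auto
    obtain \<omega>2 where 2: "\<omega>2 \<in> A" "\<omega>2 \<notin> B" "\<omega>2 \<in> H" "\<omega>2 \<in> K"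
      using logically_independent_outcome[OF indep, of True False] by auto
    obtain \<omega>3 where 3: "\<omega>3 \<notin> A" "\<omega>3 \<in> B" "\<omega>3 \<in> H" "\<omega>3 \<in> K"
      using logically_independent_outcome[OF indep, of False True] by auto
    obtain \<omega>4 where 4: "\<omega>4 \<notin> A" "\<omega>4 \<notin> B" "\<omega>4 \<in> H" "\<omega>4 \<in> K"
      using logically_independent_outcome[OF indep, of False False] by auto
    note outcomes = 1 2 3 4
    have distinct: "\<omega>1 \<noteq> \<omega>2" "\<omega>1 \<noteq> \<omega>3" "\<omega>1 \<noteq> \<omega>4" "\<omega>2 \<noteq> \<omega>3" "\<omega>2 \<noteq> \<omega>4" "\<omega>3 \<noteq> \<omega>4"
      using outcomes by auto
    have sum_outcomes: "(\<Sum>\<omega>\<in>{\<omega>1, \<omega>2, \<omega>3, \<omega>4}. f \<omega>) = f \<omega>1 + f \<omega>2 + f \<omega>3 + f \<omega>4"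
      for f :: "'a \<Rightarrow> real"
      using distinct by simp
    have outcome_values:
      "cond_event A H x \<omega>1 = 1" "cond_event B K y \<omega>1 = 1" "conjunction A H x B K y z \<omega>1 = 1"
      "cond_event A H x \<omega>2 = 1" "cond_event B K y \<omega>2 = 0" "conjunction A H x B K y z \<omega>2 = 0"
      "cond_event A H x \<omega>3 = 0" "cond_event B K y \<omega>3 = 1" "conjunction A H x B K y z \<omega>3 = 0"
      "cond_event A H x \<omega>4 = 0" "cond_event B K y \<omega>4 = 0" "conjunction A H x B K y z \<omega>4 = 0"
      using outcomes by (simp_all add: cond_event_def conjunction_def)
    \<comment> \<open>The joint law of two indicators with means \<open>x\<close>, \<open>y\<close>
      and product mean \<open>z\<close>; its four masses are nonnegative exactly under the Frechet
      bounds.\<close>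
    define w where "w = (\<lambda>\<omega>. if \<omega> = \<omega>1 then z else if \<omega> = \<omega>2 then x - z
      else if \<omega> = \<omega>3 then y - z else 1 - x - y + z)"
    have w: "w \<omega>1 = z" "w \<omega>2 = x - z" "w \<omega>3 = y - z" "w \<omega>4 = 1 - x - y + z"
      using distinct by (auto simp: w_def)
    have "coherent_on ?X ?H ?\<mu> {0, 1, 2}"
    proof (rule coherent_on_outcome_weights[where W = "{\<omega>1, \<omega>2, \<omega>3, \<omega>4}" and w = w])
      fix i :: nat assume i: "i \<in> {0, 1, 2}"
      show "finite (?X i ` ?H i)"
        using i by (auto simp: finite_image_cond_event finite_image_conjunction)
      show "{\<omega>1, \<omega>2, \<omega>3, \<omega>4} \<subseteq> ?H i"
        using i outcomes by auto
      show "(\<Sum>\<omega>\<in>{\<omega>1, \<omega>2, \<omega>3, \<omega>4}. w \<omega> * ?X i \<omega>) = ?\<mu> i"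
        unfolding sum_outcomes using i by (auto simp: w outcome_values)
    next
      show "(\<Sum>\<omega>\<in>{\<omega>1, \<omega>2, \<omega>3, \<omega>4}. w \<omega>) = 1"
        unfolding sum_outcomes by (simp add: w)
    qed (use z in \<open>auto simp: w\<close>)
    then show "coherent ?F [x, y, z]" using coherent by simp
  qed
qed

section \<open>Frank t-norms\<close>

text \<open>Separates the three special branches of \<open>frank\<close> from the logarithmic one,
  where the parameter becomes a real number.\<close>

lemma frank_cases [case_names zero one infinity general]:
  assumes "l = 0 \<Longrightarrow> P" "l = 1 \<Longrightarrow> P" "l = \<infinity> \<Longrightarrow> P"
    and "\<And>a. 0 < a \<Longrightarrow> a \<noteq> 1 \<Longrightarrow> l = ennreal a \<Longrightarrow> P"
  shows P
proof (cases l rule: ennreal_cases)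
  case (real a)
  then show ?thesis using assms(1,2,4) by (cases "a = 0 \<or> a = 1") auto
next
  case top
  then show ?thesis using assms(3) by simp
qed

lemma frank_ennreal:
  assumes "0 < a" "a \<noteq> 1"
  shows "frank (ennreal a) u v = log a (1 + (a powr u - 1) * (a powr v - 1) / (a - 1))"
  using assms by (simp add: frank_def ennreal_eq_0_iff)

lemma frank_commute: "frank l u v = frank l v u"
  by (auto simp: frank_def mult.commute add.commute min.commute)

lemma frank_zero_left:
  assumes "0 \<le> v" "v \<le> 1"
  shows "frank l 0 v = 0"
proof (cases l rule: frank_cases)
  case (general a)
  then show ?thesis by (simp add: frank_ennreal)
qed (use assms in \<open>auto simp: frank_def\<close>)

lemma frank_one_left:
  assumes "0 \<le> v" "v \<le> 1"
  shows "frank l 1 v = v"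
proof (cases l rule: frank_cases)
  case (general a)
  then show ?thesis by (simp add: frank_ennreal)
qed (use assms in \<open>auto simp: frank_def\<close>)

section \<open>Frank values lie between the Frechet bounds\<close>

lemma log_antimono:
  fixes a :: real
  assumes "0 < a" "a < 1" "0 < r" "r \<le> s"
  shows "log a s \<le> log a r"
  using assms by (simp add: log_def divide_right_mono_neg)

text \<open>With \<open>p = a powr u\<close> and \<open>q = a powr v\<close>, the bounds 0,
  \<open>u\<close>, \<open>v\<close>, \<open>u + v - 1\<close> are the logarithms of 1,
  \<open>p\<close>, \<open>q\<close>, \<open>p * q / a\<close>. The difference of \<open>r\<close>
  and each of these factors, and the signs are visible because \<open>p\<close> and \<open>q\<close>
  lie between 1 and \<open>a\<close>.\<close>

lemma frank_argument_bounds: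
  fixes a u v :: real
  assumes a: "0 < a" "a \<noteq> 1" and u: "0 \<le> u" "u \<le> 1" and v: "0 \<le> v" "v \<le> 1"
  defines "r \<equiv> 1 + (a powr u - 1) * (a powr v - 1) / (a - 1)"
  shows "max (u + v - 1) 0 \<le> log a r" and "log a r \<le> min u v"
proof -
  define p q where "p = a powr u" and "q = a powr v"
  have pos: "0 < p" "0 < q" using a by (auto simp: p_def q_def)
  have r1: "r - 1 = (p - 1) * (q - 1) / (a - 1)"
    by (simp add: r_def p_def q_def)
  have rp: "r - p = (p - 1) * (q - a) / (a - 1)"
    and rq: "r - q = (q - 1) * (p - a) / (a - 1)"
    and rpq: "r - p * q / a = (a - p) * (a - q) / (a * (a - 1))"
    using a by (simp_all add: r_def field_simps flip: p_def q_def)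
  have logs: "log a p = u" "log a q = v" "log a (p * q / a) = u + v - 1"
    using a pos by (simp_all add: log_divide log_mult) (simp_all add: p_def q_def)
  have "max (u + v - 1) 0 \<le> log a r \<and> log a r \<le> min u v"
  proof (cases "1 < a")
    case True
    have pq: "1 \<le> p" "1 \<le> q" "p \<le> a" "q \<le> a"
      using True u v powr_mono[of 0 u a] powr_mono[of 0 v a] powr_mono[of u 1 a] powr_mono[of v 1 a]
      by (auto simp: p_def q_def)
    have "0 \<le> r - 1" "0 \<le> r - p * q / a"
      unfolding r1 rpq using True pq by simp_all
    moreover have "r - p \<le> 0" "r - q \<le> 0"
      unfolding rp rq using True pq by (auto intro!: divide_nonpos_pos mult_nonneg_nonpos)
    ultimately have r: "1 \<le> r" "p * q / a \<le> r" "r \<le> p" "r \<le> q" by simp_all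
    have "log a 1 \<le> log a r" "log a (p * q / a) \<le> log a r" "log a r \<le> log a p" "log a r \<le> log a q"
      using True r pos by (simp_all add: log_le_cancel_iff del: log_one)
    then show ?thesis by (simp add: logs)
  next
    \<comment> \<open>For a base below 1 the comparisons of \<open>r\<close> are reversed, and the
      decreasing logarithm reverses them back. Positivity of \<open>r\<close> now comes from
      \<open>p \<le> r\<close>.\<close>
    case False
    then have a1: "a < 1" using a by simp
    have pq: "p \<le> 1" "q \<le> 1" "a \<le> p" "a \<le> q"
      using a1 a u v powr_mono'[of 0 u a] powr_mono'[of 0 v a] powr_mono'[of u 1 a] powr_mono'[of v 1 a]
      by (auto simp: p_def q_def)
    have "r - 1 \<le> 0"
      unfolding r1 using a1 pq by (intro divide_nonneg_neg mult_nonpos_nonpos) auto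
    moreover have "r - p * q / a \<le> 0"
      unfolding rpq using a1 a pq by (intro divide_nonneg_neg mult_nonpos_nonpos) (auto simp: mult_less_0_iff)
    moreover have "0 \<le> r - p" "0 \<le> r - q"
      unfolding rp rq using a1 pq by (auto intro!: divide_nonpos_neg mult_nonpos_nonneg)
    ultimately have r: "r \<le> 1" "r \<le> p * q / a" "p \<le> r" "q \<le> r" by simp_all
    then have "0 < r" using pos by simp
    then have "log a 1 \<le> log a r" "log a (p * q / a) \<le> log a r" "log a r \<le> log a p" "log a r \<le> log a q"
      using a a1 r pos by (auto intro!: log_antimono simp del: log_one)
    then show ?thesis by (simp add: logs)
  qed
  then show "max (u + v - 1) 0 \<le> log a r" "log a r \<le> min u v" by simp_all
qed

lemma frank_Frechet:
  assumes u: "0 \<le> u" "u \<le> 1" and v: "0 \<le> v" "v \<le> 1"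
  shows "max (u + v - 1) 0 \<le> frank l u v \<and> frank l u v \<le> min u v"
proof (cases l rule: frank_cases)
  case one
  have "0 \<le> (1 - u) * (1 - v)" using u v by simp
  then have "u + v - 1 \<le> u * v" by (simp add: algebra_simps)
  then show ?thesis
    using one u v by (simp add: frank_def mult_left_le mult_left_le_one_le)
next
  case (general a)
  then show ?thesis
    using frank_argument_bounds[OF general(1,2) u v] by (simp add: frank_ennreal)
qed (use u v in \<open>auto simp: frank_def min_def\<close>)

text \<open>If \<open>H\<close> or \<open>K\<close> is true, one argument is 0 or 1, which is
  absorbing or neutral for \<open>frank\<close>. If both are false, both sides equal
  \<open>frank l x y\<close> by the choice of prevision.\<close>

lemma conjunction_eq_frank:
  assumes "x \<in> {0..1}" "y \<in> {0..1}"
  shows "conjunction A H x B K y (frank l x y) \<omega>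
       = frank l (cond_event A H x \<omega>) (cond_event B K y \<omega>)"
proof -
  have left: "frank l 0 t = 0" "frank l 1 t = t" if "t \<in> {0, 1, x, y}" for t
    using that assms by (auto intro!: frank_zero_left frank_one_left)
  have right: "frank l t 0 = 0" "frank l t 1 = t" if "t \<in> {0, 1, x, y}" for t
    using left[OF that] by (simp_all only: frank_commute[of l t])
  show ?thesis
    by (auto simp: conjunction_def cond_event_def left right)
qed

section \<open>Solving for the Frank parameter\<close>

lemma tendsto_powr_minus_one_quotient:
  fixes c :: real
  shows "((\<lambda>a. (a powr c - 1) / (a - 1)) \<longlongrightarrow> c) (at 1)"
proof -
  have "((\<lambda>a. a powr c) has_real_derivative c) (at 1)"
    by (auto intro!: derivative_eq_intros)
  then show ?thesis
    by (simp add: has_field_derivative_iff)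
qed

text \<open>The equation for the parameter has a spurious root at 1, where both sides vanish to
  second order. Dividing by \<open>(a - 1)\<^sup>2\<close> exposes the sign of the difference on
  either side of that root.\<close>

lemma frank_equation_near_one:
  fixes x y z :: real
  shows "((\<lambda>a. ((a powr x - 1) * (a powr y - 1) - (a powr z - 1) * (a - 1)) / (a - 1)\<^sup>2)
           \<longlongrightarrow> x * y - z) (at 1)"
proof (rule Lim_transform_eventually)
  show "((\<lambda>a. (a powr x - 1) / (a - 1) * ((a powr y - 1) / (a - 1)) - (a powr z - 1) / (a - 1))
           \<longlongrightarrow> x * y - z) (at 1)"
    by (intro tendsto_intros tendsto_powr_minus_one_quotient)
  show "\<forall>\<^sub>F a in at 1. (a powr x - 1) / (a - 1) * ((a powr y - 1) / (a - 1)) - (a powr z - 1) / (a - 1)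
      = ((a powr x - 1) * (a powr y - 1) - (a powr z - 1) * (a - 1)) / (a - 1)\<^sup>2"
  proof -
    have "P / d * (Q / d) - R / d = (P * Q - R * d) / d\<^sup>2" if "d \<noteq> 0" for P Q R d :: real
      using that by (simp add: power2_eq_square diff_divide_distrib)
    then show ?thesis
      by (simp add: eventually_at_filter)
  qed
qed

lemma frank_equation_solvable_above_product:
  fixes x y z :: real
  assumes z: "0 < z" "z < x" "z < y" "x < 1" "y < 1" "x * y < z"
  shows "\<exists>a. 0 < a \<and> a < 1 \<and> (a powr x - 1) * (a powr y - 1) = (a powr z - 1) * (a - 1)"
proof -
  define F where "F = (\<lambda>a. (a powr x - 1) * (a powr y - 1) - (a powr z - 1) * (a - 1))"
  have lim0: "((\<lambda>a::real. a powr c) \<longlongrightarrow> 0) (at_right 0)" if "0 < c" for c :: real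
    using that tendsto_powr[of "\<lambda>a. a" 0 "at_right 0" "\<lambda>_. c" c]
    by (auto intro!: tendsto_eq_intros simp: eventually_at_right_less eventually_mono[OF eventually_at_right_less])
  \<comment> \<open>The function is \<open>F a\<close> divided by \<open>a powr z\<close>; since
    \<open>z < x\<close>, \<open>z < y\<close> and \<open>z < 1\<close>, all exponents are positive
    and only the constant 1 survives at 0.\<close>
  have "((\<lambda>a. 1 + a powr (1 - z) + a powr (x + y - z) - a powr (x - z) - a powr (y - z) - a)
          \<longlongrightarrow> 1 + 0 + 0 - 0 - 0 - 0) (at_right 0)"
    using z by (intro tendsto_intros lim0) auto
  then have "\<forall>\<^sub>F a in at_right 0. 0 < 1 + a powr (1 - z) + a powr (x + y - z) - a powr (x - z) - a powr (y - z) - a"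
    by (rule order_tendstoD) simp
  then obtain a0 where a0: "0 < a0" "\<And>a. 0 < a \<Longrightarrow> a < a0 \<Longrightarrow>
      0 < 1 + a powr (1 - z) + a powr (x + y - z) - a powr (x - z) - a powr (y - z) - a"
    by (auto simp: eventually_at_right_field)
  have "\<forall>\<^sub>F a in at 1. F a / (a - 1)\<^sup>2 < 0"
    unfolding F_def using frank_equation_near_one by (rule order_tendstoD) (use z in simp)
  then have "\<forall>\<^sub>F a in at_left 1. F a / (a - 1)\<^sup>2 < 0"
    by (auto simp: eventually_at_split)
  then obtain a1 where a1: "a1 < 1" "\<And>a. a1 < a \<Longrightarrow> a < 1 \<Longrightarrow> F a / (a - 1)\<^sup>2 < 0"
    by (auto simp: eventually_at_left_field)
  \<comment> \<open>\<open>b\<close> lies in the range near 0 where \<open>F\<close> is positive,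
    and \<open>c\<close>, to the right of \<open>b\<close>, in the range below 1 where
    \<open>F\<close> is negative.\<close>
  define b where "b = min a0 1 / 2"
  define c where "c = (max a1 b + 1) / 2"
  have b: "0 < b" "b < a0" "b < 1" using a0 by (auto simp: b_def)
  have c: "b < c" "a1 < c" "c < 1" using a1 b by (auto simp: c_def)
  have "F b = b powr z * (1 + b powr (1 - z) + b powr (x + y - z) - b powr (x - z) - b powr (y - z) - b)"
    using b by (simp add: F_def algebra_simps flip: powr_add)
  then have "0 < F b" using a0(2) b by simp
  moreover have "F c < 0" using a1(2)[of c] c by (simp add: divide_less_0_iff not_less_iff_gr_or_eq)
  moreover have "continuous_on {b..c} F"
    unfolding F_def using b by (intro continuous_intros) auto
  ultimately obtain a where "b \<le> a" "a \<le> c" "F a = 0"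
    using IVT2'[of F c 0 b] c by auto
  then show ?thesis using b c by (intro exI[of _ a]) (auto simp: F_def)
qed

lemma frank_equation_solvable_below_product:
  fixes x y z :: real
  assumes z: "0 < z" "x + y - 1 < z" "0 < x" "0 < y" "x < 1" "y < 1" "z < x * y"
  shows "\<exists>a>1. (a powr x - 1) * (a powr y - 1) = (a powr z - 1) * (a - 1)"
proof -
  define F where "F = (\<lambda>a. (a powr x - 1) * (a powr y - 1) - (a powr z - 1) * (a - 1))"
  have lim: "((\<lambda>a::real. a powr c) \<longlongrightarrow> 0) at_top" if "c < 0" for c :: real
    using that by (intro tendsto_neg_powr filterlim_ident)
  \<comment> \<open>The function is \<open>F a\<close> divided by \<open>a powr (z + 1)\<close>. All
    exponents are negative, the first one because \<open>x + y - 1 < z\<close>, so the limit is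
    -1.\<close>
  have "((\<lambda>a. a powr (x + y - 1 - z) - a powr (x - 1 - z) - a powr (y - 1 - z) + a powr (- z) + a powr (- 1) - 1)
          \<longlongrightarrow> 0 - 0 - 0 + 0 + 0 - 1) at_top"
    using z by (intro tendsto_intros lim) auto
  then have "\<forall>\<^sub>F a in at_top. a powr (x + y - 1 - z) - a powr (x - 1 - z) - a powr (y - 1 - z)
      + a powr (- z) + a powr (- 1) - 1 < 0"
    by (rule order_tendstoD) simp
  then obtain a0 where a0: "\<And>a. a0 \<le> a \<Longrightarrow> a powr (x + y - 1 - z) - a powr (x - 1 - z) - a powr (y - 1 - z)
      + a powr (- z) + a powr (- 1) - 1 < 0"
    by (auto simp: eventually_at_top_linorder)
  have "\<forall>\<^sub>F a in at 1. 0 < F a / (a - 1)\<^sup>2"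
    unfolding F_def using frank_equation_near_one by (rule order_tendstoD) (use z in simp)
  then have "\<forall>\<^sub>F a in at_right 1. 0 < F a / (a - 1)\<^sup>2"
    by (auto simp: eventually_at_split)
  then obtain a1 where a1: "1 < a1" "\<And>a. 1 < a \<Longrightarrow> a < a1 \<Longrightarrow> 0 < F a / (a - 1)\<^sup>2"
    by (auto simp: eventually_at_right_field)
  \<comment> \<open>\<open>b\<close> lies just above 1, where \<open>F\<close> is positive; the
    maximum in \<open>c\<close> keeps it to the right of \<open>b\<close> and in the range where
    \<open>F\<close> is negative.\<close>
  define b where "b = (1 + a1) / 2"
  define c where "c = max a0 b"
  have b: "1 < b" "b < a1" using a1 by (auto simp: b_def)
  have c: "b \<le> c" "a0 \<le> c" by (auto simp: c_def)
  have "F c = c powr (z + 1) * (c powr (x + y - 1 - z) - c powr (x - 1 - z) - c powr (y - 1 - z)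
      + c powr (- z) + c powr (- 1) - 1)"
    using b c by (simp add: F_def algebra_simps flip: powr_add) (simp add: powr_add)
  then have "F c < 0" using a0[of c] b c by (simp add: mult_pos_neg)
  moreover have "0 < F b" using a1(2)[of b] b by (simp add: zero_less_divide_iff)
  moreover have "continuous_on {b..c} F"
    unfolding F_def using b by (intro continuous_intros) auto
  ultimately obtain a where "b \<le> a" "a \<le> c" "F a = 0"
    using IVT2'[of F c 0 b] c by auto
  then show ?thesis using b c by (intro exI[of _ a]) (auto simp: F_def)
qed

lemma frank_surj_Frechet:
  assumes x: "0 \<le> x" "x \<le> 1" and y: "0 \<le> y" "y \<le> 1"
    and z: "max (x + y - 1) 0 \<le> z" "z \<le> min x y"
  shows "\<exists>l. z = frank l x y"
proof -
  consider "z = min x y" | "z = max (x + y - 1) 0" | "z = x * y"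
    | "z < min x y" "max (x + y - 1) 0 < z" "z \<noteq> x * y"
    using z by linarith
  then show ?thesis
  proof cases
    case 1
    then show ?thesis by (intro exI[of _ 0]) (simp add: frank_def)
  next
    case 2
    then show ?thesis by (intro exI[of _ \<infinity>]) (simp add: frank_def max.commute add.commute)
  next
    case 3
    then show ?thesis by (intro exI[of _ 1]) (simp add: frank_def)
  next
    case 4
    \<comment> \<open>Strict bounds exclude the boundary of the unit square:
      \<open>x + y - 1 < z < y\<close> gives \<open>x < 1\<close>, and symmetrically for
      \<open>y\<close>.\<close>
    then have bounds: "0 < z" "x + y - 1 < z" "z < x" "z < y" "x < 1" "y < 1"
      by simp_all
    obtain a where a: "0 < a" "a \<noteq> 1" "(a powr x - 1) * (a powr y - 1) = (a powr z - 1) * (a - 1)"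
    proof (cases "x * y < z")
      case True
      then show ?thesis
        using frank_equation_solvable_above_product[of z x y] bounds that by (metis less_irrefl)
    next
      case False
      then have "\<exists>a>1. (a powr x - 1) * (a powr y - 1) = (a powr z - 1) * (a - 1)"
        using bounds 4(3) by (intro frank_equation_solvable_below_product) auto
      then show ?thesis
        using that by (metis less_irrefl less_trans zero_less_one)
    qed
    \<comment> \<open>After division by \<open>a - 1\<close> the argument of the logarithm is
      \<open>a powr z\<close>.\<close>
    then have "frank (ennreal a) x y = z"
      by (simp add: frank_ennreal)
    then show ?thesis by blast
  qed
qed

theorem theorem4:
  fixes A B H K :: "'w set" and x y :: real
  assumes "logically_independent [A, B, H, K]"
    and "x \<in> {0..1}" and "y \<in> {0..1}"
  shows "(\<forall>l :: ennreal. \<forall>z. z = frank l x y \<longrightarrow>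
            coherent [(cond_event A H x, H), (cond_event B K y, K),
                      (conjunction A H x B K y z, H \<union> K)] [x, y, z] \<and>
            conjunction A H x B K y z =
              (\<lambda>\<omega>. frank l (cond_event A H x \<omega>) (cond_event B K y \<omega>))) \<and>
         (\<forall>z. coherent [(cond_event A H x, H), (cond_event B K y, K),
                        (conjunction A H x B K y z, H \<union> K)] [x, y, z] \<longrightarrow>
            (\<exists>l :: ennreal. z = frank l x y))"
proof (intro conjI allI impI)
  fix l z assume z: "z = frank l x y"
  show "coherent [(cond_event A H x, H), (cond_event B K y, K),
          (conjunction A H x B K y z, H \<union> K)] [x, y, z]"
    unfolding coherent_conjunction_iff_Frechet[OF assms] z
    using assms(2,3) by (intro frank_Frechet) simp_all
  show "conjunction A H x B K y z = (\<lambda>\<omega>. frank l (cond_event A H x \<omega>) (cond_event B K y \<omega>))"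
    unfolding z by (rule ext) (rule conjunction_eq_frank[OF assms(2,3)])
next
  fix z assume "coherent [(cond_event A H x, H), (cond_event B K y, K),
    (conjunction A H x B K y z, H \<union> K)] [x, y, z]"
  then show "\<exists>l. z = frank l x y"
    unfolding coherent_conjunction_iff_Frechet[OF assms]
    using assms(2,3) by (intro frank_surj_Frechet) simp_all
qed

end
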